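(* Let $m, S\ge 1$ be integers and let $\mu=(\mu_1,\dots,\mu_S)\in\Delta_S$. Let $p_1,\dots,p_S:\mathbb{R}^m\to(0,\infty)$ be differentiable log-concave functions, and let $F:\mathbb{R}^m\to\mathbb{R}$ be given by $F(\theta)=-\log\left(\sum_{s=1}^S p_s(\theta)\right)$. Assume that every partial loss function $\ell_s=-\log p_s$ ($1\le s\le S$) is $B$-Lipschitz continuous on $\mathbb{R}^m$ with respect to the Euclidean norm. Let $\theta_0\in\mathbb{R}^m$, let $T\ge 1$, let $\gamma_1,\dots,\gamma_T>0$, and define for $1\le t\le T$ $$\theta_t=\theta_{t-1}-\gamma_t\nabla^{\mu}F(\theta_{t-1})=\theta_{t-1}+\gamma_t\sum_{s=1}^S\mu_s\frac{\nabla p_s(\theta_{t-1})}{p_s(\theta_{t-1})}.$$ Then for all $\eta\in\mathcal{E}(\mu)$, $$\frac{1}{\sum_{t=1}^T\gamma_t}\sum_{t=1}^T\gamma_t\left(F(\theta_{t-1})-F(\eta)\right)\le\frac{\|\theta_0-\eta\|^2}{2\sum_{t=1}^T\gamma_t}+B^2\,\frac{\sum_{t=1}^T\gamma_t^2}{2\sum_{t=1}^T\gamma_t}.$$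
   Context: $\Delta_S=\{\mu\in[0,1]^S:\mu_1+\dots+\mu_S=1\}$ is the probability simplex and $\|\cdot\|$ is the Euclidean norm. A function $p:\mathbb{R}^m\to(0,\infty)$ is log-concave if $\log p$ is concave. Given the representation $F=-\log(\sum_{s=1}^S p_s)$, the cross-gradients of $F$ at $\theta\in\mathbb{R}^m$ are defined, for $\mu\in\Delta_S$ and for $\eta\in\mathbb{R}^m$ respectively, by $$\nabla^{\mu}F(\theta)=-\sum_{s=1}^S\mu_s\frac{\nabla p_s(\theta)}{p_s(\theta)},\qquad \nabla^{\eta}F(\theta)=-\sum_{s=1}^S\frac{p_s(\eta)}{\sum_{s'=1}^S p_{s'}(\eta)}\frac{\nabla p_s(\theta)}{p_s(\theta)}.$$ The set $\mathcal{E}(\mu)$ is $$\mathcal{E}(\mu)=\left\{\eta\in\mathbb{R}^m:\ \nabla^{\eta}F(\theta)=\nabla^{\mu}F(\theta)\ \text{for all }\theta\in\mathbb{R}^m\right\}.$$ *)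

theory Defs
  imports "HOL-Analysis.Analysis"
begin

text \<open>
  Families \<open>p\<^sub>1, \<dots>, p\<^sub>S\<close> and weights \<open>\<mu>\<^sub>1, \<dots>, \<mu>\<^sub>S\<close> are functions on \<^typ>\<open>nat\<close>, of which only
  the values at indices in \<^term>\<open>{1..S}\<close> matter.
\<close>

definition prob_simplex :: "nat \<Rightarrow> (nat \<Rightarrow> real) set" where
  "prob_simplex S = {\<mu>. (\<forall>s\<in>{1..S}. \<mu> s \<in> {0..1}) \<and> (\<Sum>s=1..S. \<mu> s) = 1}"

definition log_concave :: "('a::real_vector \<Rightarrow> real) \<Rightarrow> bool" where
  "log_concave p \<longleftrightarrow> (\<forall>x. 0 < p x) \<and> concave_on UNIV (\<lambda>x. ln (p x))"

text \<open>The value is unspecified at points where \<open>f\<close> is not differentiable.\<close>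

definition gradient :: "('a::real_inner \<Rightarrow> real) \<Rightarrow> 'a \<Rightarrow> 'a" where
  "gradient f x = (THE D. GDERIV f x :> D)"

lemma gradient_eqI:
  assumes "GDERIV f x :> D"
  shows "gradient f x = D"
  unfolding gradient_def
proof (rule the_equality)
  show "GDERIV f x :> D" by fact
next
  fix E assume "GDERIV f x :> E"
  with assms have "(\<lambda>h. inner h E) = (\<lambda>h. inner h D)"
    unfolding gderiv_def by (metis has_derivative_unique)
  then show "E = D"
    by (metis vector_eq_ldot)
qed

lemma GDERIV_gradient:
  fixes f :: "'a::euclidean_space \<Rightarrow> real"
  assumes "f differentiable at x"
  shows "GDERIV f x :> gradient f x"
proof -
  obtain f' where f': "(f has_derivative f') (at x)"
    using assms by (auto simp: differentiable_def)
  then have "bounded_linear f'"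
    by (rule has_derivative_bounded_linear)
  then have "f' = (\<lambda>h. inner h (adjoint f' 1))"
    by (metis adjoint_works bounded_linear.linear inner_real_def mult.right_neutral)
  with f' have "GDERIV f x :> adjoint f' 1"
    unfolding gderiv_def by simp
  with gradient_eqI show ?thesis
    by metis
qed

definition mix_loss :: "nat \<Rightarrow> (nat \<Rightarrow> 'a \<Rightarrow> real) \<Rightarrow> 'a \<Rightarrow> real" where
  "mix_loss S p \<theta> = - ln (\<Sum>s=1..S. p s \<theta>)"

text \<open>
  The two cross-gradients of \<^term>\<open>mix_loss S p\<close>.  They depend on the representation \<open>p\<close> and not
  only on the function \<^term>\<open>mix_loss S p\<close>.
\<close>

definition cross_gradient_weight ::
    "nat \<Rightarrow> (nat \<Rightarrow> 'a::real_inner \<Rightarrow> real) \<Rightarrow> (nat \<Rightarrow> real) \<Rightarrow> 'a \<Rightarrow> 'a" where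
  "cross_gradient_weight S p \<mu> \<theta> =
     - (\<Sum>s=1..S. \<mu> s *\<^sub>R (gradient (p s) \<theta> /\<^sub>R p s \<theta>))"

definition cross_gradient_point ::
    "nat \<Rightarrow> (nat \<Rightarrow> 'a::real_inner \<Rightarrow> real) \<Rightarrow> 'a \<Rightarrow> 'a \<Rightarrow> 'a" where
  "cross_gradient_point S p \<eta> \<theta> =
     - (\<Sum>s=1..S. (p s \<eta> / (\<Sum>s'=1..S. p s' \<eta>)) *\<^sub>R (gradient (p s) \<theta> /\<^sub>R p s \<theta>))"

definition cross_gradient_set ::
    "nat \<Rightarrow> (nat \<Rightarrow> 'a::real_inner \<Rightarrow> real) \<Rightarrow> (nat \<Rightarrow> real) \<Rightarrow> 'a set" where
  "cross_gradient_set S p \<mu> =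
     {\<eta>. \<forall>\<theta>. cross_gradient_point S p \<eta> \<theta> = cross_gradient_weight S p \<mu> \<theta>}"

end

theory Submission
  imports Defs
begin

text \<open>
  Jensen's inequality for the logarithm, with weights \<open>p\<^sub>s(\<eta>) / \<Sum>\<^sub>s' p\<^sub>s'(\<eta>)\<close>, bounds
  \<open>F(\<theta>) - F(\<eta>)\<close> by the weighted average of \<open>ln p\<^sub>s(\<eta>) - ln p\<^sub>s(\<theta>)\<close>; replacing each concave
  \<open>ln p\<^sub>s\<close> by its tangent at \<open>\<theta>\<close> turns this into \<open>F(\<theta>) - F(\<eta>) \<le> \<langle>\<nabla>\<^sup>\<eta>F(\<theta>), \<theta> - \<eta>\<rangle>\<close>.  For \<open>\<eta>\<close> in the
  cross-gradient set, \<open>\<nabla>\<^sup>\<eta>F\<close> is the direction \<open>\<nabla>\<^sup>\<mu>F\<close> of the iteration, which has norm at most \<open>B\<close>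
  as a convex combination of gradients of \<open>B\<close>-Lipschitz functions.  The bound is then the usual
  estimate for the subgradient method.
\<close>

text \<open>The limit is taken from the right because the tangent and Lipschitz bounds below control
  the quotient only for positive \<open>t\<close>.\<close>

lemma GDERIV_difference_quotient_at_right:
  assumes "GDERIV f x :> D"
  shows "((\<lambda>t. (f (x + t *\<^sub>R h) - f x) / t) \<longlongrightarrow> inner h D) (at_right 0)"
proof -
  have f: "(f has_derivative (\<lambda>h. inner h D)) (at (x + 0 *\<^sub>R h))"
    using assms by (simp add: gderiv_def)
  have "((\<lambda>t. f (x + t *\<^sub>R h)) has_derivative (\<lambda>t. inner (t *\<^sub>R h) D)) (at (0::real))"
    by (rule has_derivative_compose[where f = "\<lambda>t. x + t *\<^sub>R h", OF _ f]) (auto intro!: derivative_eq_intros)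
  then have "((\<lambda>t. f (x + t *\<^sub>R h)) has_field_derivative inner h D) (at 0)"
    by (simp add: has_field_derivative_def mult_commute_abs)
  then have "((\<lambda>t. (f (x + t *\<^sub>R h) - f x) / t) \<longlongrightarrow> inner h D) (at 0)"
    by (simp add: has_field_derivative_iff)
  then show ?thesis
    by (rule tendsto_mono[OF at_le, rotated]) simp
qed

text \<open>Concavity on the segment from \<open>x\<close> to \<open>y\<close> keeps the difference
  quotient at every \<open>t\<close> in (0,1) above its value \<open>f y - f x\<close> at
  \<open>t = 1\<close>; this bound survives the limit \<open>t\<close> to 0.\<close>

lemma concave_on_below_tangent:
  assumes f: "concave_on UNIV f" and D: "GDERIV f x :> D"
  shows "f y - f x \<le> inner (y - x) D"
proof (rule tendsto_lowerbound[OF GDERIV_difference_quotient_at_right[OF D]])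
  have "f y - f x \<le> (f (x + t *\<^sub>R (y - x)) - f x) / t" if "0 < t" "t < 1" for t
  proof -
    have "(1 - t) * f x + t * f y \<le> f ((1 - t) *\<^sub>R x + t *\<^sub>R y)"
      using concave_onD[OF f] that by simp
    also have "(1 - t) *\<^sub>R x + t *\<^sub>R y = x + t *\<^sub>R (y - x)"
      by (simp add: algebra_simps)
    finally show ?thesis
      using that by (simp add: field_simps)
  qed
  then show "\<forall>\<^sub>F t in at_right 0. f y - f x \<le> (f (x + t *\<^sub>R (y - x)) - f x) / t"
    by (auto simp: eventually_at_right_field intro!: exI[of _ 1])
qed simp

text \<open>Moving in the direction \<open>D\<close> itself, the quotients are at most
  \<open>B * norm D\<close> and tend to \<open>inner D D\<close>, the square of
  \<open>norm D\<close>.\<close>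

lemma norm_gradient_le_lipschitz:
  assumes f: "B-lipschitz_on UNIV f" and D: "GDERIV f x :> D"
  shows "norm D \<le> B"
proof -
  have "inner D D \<le> B * norm D"
  proof (rule tendsto_upperbound[OF GDERIV_difference_quotient_at_right[OF D]])
    have "(f (x + t *\<^sub>R D) - f x) / t \<le> B * norm D" if "0 < t" for t
      using lipschitz_on_normD[OF f, of "x + t *\<^sub>R D" x] that by (simp add: field_simps)
    then show "\<forall>\<^sub>F t in at_right 0. (f (x + t *\<^sub>R D) - f x) / t \<le> B * norm D"
      by (auto simp: eventually_at_right_field intro!: exI[of _ 1])
  qed simp
  then have "norm D * norm D \<le> B * norm D"
    by (simp add: power2_norm_eq_inner flip: power2_eq_square)
  \<comment> \<open>Cancelling \<open>norm D\<close> requires \<open>D\<close> nonzero; for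
    \<open>D = 0\<close> the claim is just that a Lipschitz constant is nonnegative.\<close>
  with lipschitz_on_nonneg[OF f] show ?thesis
    by (cases "D = 0") auto
qed

lemma GDERIV_ln_gradient:
  fixes p :: "'a::euclidean_space \<Rightarrow> real"
  assumes "p differentiable at x" "0 < p x"
  shows "GDERIV (\<lambda>x. ln (p x)) x :> gradient p x /\<^sub>R p x"
  using GDERIV_DERIV_compose[OF GDERIV_gradient[OF assms(1)] DERIV_ln[OF assms(2)]] by simp

lemma norm_cross_gradient_weight_le:
  fixes p :: "nat \<Rightarrow> 'a::euclidean_space \<Rightarrow> real"
  assumes \<mu>: "\<mu> \<in> prob_simplex S"
    and diff: "\<And>s. s \<in> {1..S} \<Longrightarrow> p s differentiable at x"
    and pos: "\<And>s. s \<in> {1..S} \<Longrightarrow> 0 < p s x"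
    and lipschitz: "\<And>s. s \<in> {1..S} \<Longrightarrow> B-lipschitz_on UNIV (\<lambda>x. - ln (p s x))"
  shows "norm (cross_gradient_weight S p \<mu> x) \<le> B"
proof -
  \<comment> \<open>The scaled gradient is that of \<open>ln (p s)\<close>; negating it gives the
    gradient of the Lipschitz loss, with the same norm.\<close>
  have le_B: "norm (gradient (p s) x /\<^sub>R p s x) \<le> B" if "s \<in> {1..S}" for s
    using norm_gradient_le_lipschitz[OF lipschitz GDERIV_minus[OF GDERIV_ln_gradient]]
      that diff pos by (simp del: norm_scaleR)
  have "norm (cross_gradient_weight S p \<mu> x)
      \<le> (\<Sum>s=1..S. norm (\<mu> s *\<^sub>R (gradient (p s) x /\<^sub>R p s x)))"
    unfolding cross_gradient_weight_def norm_minus_cancel by (rule norm_sum)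
  also have "\<dots> \<le> (\<Sum>s=1..S. \<mu> s * B)"
  proof (rule sum_mono)
    fix s assume s: "s \<in> {1..S}"
    then have "0 \<le> \<mu> s"
      using \<mu> by (auto simp: prob_simplex_def)
    with le_B[OF s] show "norm (\<mu> s *\<^sub>R (gradient (p s) x /\<^sub>R p s x)) \<le> \<mu> s * B"
      unfolding norm_scaleR[of "\<mu> s"] by (simp add: mult_left_mono del: norm_scaleR)
  qed
  also have "\<dots> = B"
    using \<mu> by (simp add: prob_simplex_def flip: sum_distrib_right)
  finally show ?thesis .
qed

lemma mix_loss_diff_le_cross_gradient_point:
  fixes p :: "nat \<Rightarrow> 'a::euclidean_space \<Rightarrow> real"
  assumes S: "S \<ge> 1"
    and diff: "\<And>s. s \<in> {1..S} \<Longrightarrow> p s differentiable at x"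
    and p: "\<And>s. s \<in> {1..S} \<Longrightarrow> log_concave (p s)"
  shows "mix_loss S p x - mix_loss S p y \<le> inner (cross_gradient_point S p y x) (x - y)"
proof -
  have pos: "0 < p s z" and concave: "concave_on UNIV (\<lambda>x. ln (p s x))"
    if "s \<in> {1..S}" for s z
    using p[OF that] by (auto simp: log_concave_def)
  define P where "P z = (\<Sum>s=1..S. p s z)" for z
  define w where "w s = p s y / P y" for s
  have P: "0 < P z" for z
    unfolding P_def using S pos by (intro sum_pos) auto
  have w: "0 \<le> w s" if "s \<in> {1..S}" for s
    using P[of y] pos[OF that, of y] by (simp add: w_def)
  have sum_w: "(\<Sum>s=1..S. w s) = 1"
    using P[of y] by (simp add: w_def P_def flip: sum_divide_distrib)
  \<comment> \<open>Jensen is applied to the ratios \<open>p s x / p s y\<close>: the numerator of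
    \<open>w s\<close> cancels their denominator, so their average is exactly
    \<open>P x / P y\<close>.\<close>
  have "(\<Sum>s=1..S. w s * ln (p s x / p s y)) \<le> ln (\<Sum>s=1..S. w s *\<^sub>R (p s x / p s y))"
    using S pos w sum_w by (intro concave_on_sum[OF _ _ ln_concave]) auto
  also have "(\<Sum>s=1..S. w s *\<^sub>R (p s x / p s y)) = (\<Sum>s=1..S. p s x / P y)"
    using pos by (intro sum.cong refl) (auto simp: w_def less_imp_neq[symmetric])
  also have "\<dots> = P x / P y"
    by (simp add: P_def sum_divide_distrib)
  finally have "mix_loss S p x - mix_loss S p y \<le> - (\<Sum>s=1..S. w s * ln (p s x / p s y))"
    unfolding mix_loss_def P_def[symmetric]
    using P[of x] P[of y] by (simp add: ln_div less_imp_neq[symmetric])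
  also have "\<dots> = (\<Sum>s=1..S. w s * (ln (p s y) - ln (p s x)))"
    unfolding sum_negf[symmetric] using pos
    by (intro sum.cong refl) (simp add: ln_div less_imp_neq[symmetric] right_diff_distrib)
  also have "\<dots> \<le> (\<Sum>s=1..S. w s * inner (y - x) (gradient (p s) x /\<^sub>R p s x))"
    using w pos diff concave
    by (intro sum_mono mult_left_mono concave_on_below_tangent GDERIV_ln_gradient) auto
  also have "\<dots> = inner (y - x) (\<Sum>s=1..S. w s *\<^sub>R (gradient (p s) x /\<^sub>R p s x))"
    by (simp add: inner_sum_right mult.assoc)
  \<comment> \<open>The minus sign in the cross-gradient is absorbed by reversing
    \<open>y - x\<close>.\<close>
  also have "\<dots> = inner (cross_gradient_point S p y x) (x - y)"
    unfolding cross_gradient_point_def P_def[symmetric] w_def[symmetric]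
    by (simp add: inner_commute[of "y - x"] inner_diff_right)
  finally show ?thesis .
qed

text \<open>Expanding the squared distance to \<open>\<eta>\<close> after each step produces the
  inner product as the cross term; the squared distances telescope. The vectors \<open>g t\<close>
  need not be gradients here.\<close>

lemma subgradient_iteration_sum_le:
  fixes \<theta> g :: "nat \<Rightarrow> 'a::real_inner"
  assumes step: "\<And>t. t \<in> {1..T} \<Longrightarrow> \<theta> t = \<theta> (t - 1) - \<gamma> t *\<^sub>R g t"
    and g: "\<And>t. t \<in> {1..T} \<Longrightarrow> norm (g t) \<le> B"
  shows "2 * (\<Sum>t=1..T. \<gamma> t * inner (g t) (\<theta> (t - 1) - \<eta>))
    \<le> (norm (\<theta> 0 - \<eta>))\<^sup>2 + B\<^sup>2 * (\<Sum>t=1..T. (\<gamma> t)\<^sup>2)"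
proof -
  \<comment> \<open>The sign makes \<open>d t - d (t - 1)\<close> the decrease of the squared
    distance in step \<open>t\<close>.\<close>
  define d where "d t = - (norm (\<theta> t - \<eta>))\<^sup>2" for t
  have "2 * (\<gamma> t * inner (g t) (\<theta> (t - 1) - \<eta>)) \<le> (d t - d (t - 1)) + B\<^sup>2 * (\<gamma> t)\<^sup>2"
    if t: "t \<in> {1..T}" for t
  proof -
    have "\<theta> t - \<eta> = (\<theta> (t - 1) - \<eta>) - \<gamma> t *\<^sub>R g t"
      using step[OF t] by simp
    then have "(norm (\<theta> t - \<eta>))\<^sup>2 = (norm (\<theta> (t - 1) - \<eta>))\<^sup>2
        - 2 * (\<gamma> t * inner (g t) (\<theta> (t - 1) - \<eta>)) + (\<gamma> t)\<^sup>2 * (norm (g t))\<^sup>2"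
      by (simp only: power2_norm_eq_inner)
        (simp add: inner_diff_left inner_diff_right inner_commute power2_eq_square algebra_simps)
    moreover have "(\<gamma> t)\<^sup>2 * (norm (g t))\<^sup>2 \<le> (\<gamma> t)\<^sup>2 * B\<^sup>2"
      using g[OF t] by (intro mult_left_mono power_mono) auto
    ultimately show ?thesis
      by (simp add: d_def mult.commute)
  qed
  then have "2 * (\<Sum>t=1..T. \<gamma> t * inner (g t) (\<theta> (t - 1) - \<eta>))
      \<le> (\<Sum>t=1..T. (d t - d (t - 1)) + B\<^sup>2 * (\<gamma> t)\<^sup>2)"
    unfolding sum_distrib_left by (rule sum_mono)
  also have "\<dots> = d T - d 0 + B\<^sup>2 * (\<Sum>t=1..T. (\<gamma> t)\<^sup>2)"
    using sum_telescope''[of 0 T d] by (simp add: sum.distrib sum_distrib_left)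
  \<comment> \<open>The final term \<open>d T\<close> is nonpositive and is dropped.\<close>
  also have "\<dots> \<le> (norm (\<theta> 0 - \<eta>))\<^sup>2 + B\<^sup>2 * (\<Sum>t=1..T. (\<gamma> t)\<^sup>2)"
    by (simp add: d_def)
  finally show ?thesis .
qed

theorem theorem4p2:
  fixes S T :: nat
    and \<mu> :: "nat \<Rightarrow> real"
    and p :: "nat \<Rightarrow> real ^ 'm \<Rightarrow> real"
    and F :: "real ^ 'm \<Rightarrow> real"
    and B :: real
    and \<gamma> :: "nat \<Rightarrow> real"
    and \<theta> :: "nat \<Rightarrow> real ^ 'm"
  assumes S: "S \<ge> 1"
    and \<mu>: "\<mu> \<in> prob_simplex S"
    and p_diff: "\<And>s x. s \<in> {1..S} \<Longrightarrow> p s differentiable at x"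
    and p_log_concave: "\<And>s. s \<in> {1..S} \<Longrightarrow> log_concave (p s)"
    and F: "F = mix_loss S p"
    and lipschitz: "\<And>s. s \<in> {1..S} \<Longrightarrow> B-lipschitz_on UNIV (\<lambda>x. - ln (p s x))"
    and T: "T \<ge> 1"
    and \<gamma>: "\<And>t. t \<in> {1..T} \<Longrightarrow> \<gamma> t > 0"
    and \<theta>: "\<And>t. t \<in> {1..T} \<Longrightarrow>
              \<theta> t = \<theta> (t - 1) - \<gamma> t *\<^sub>R cross_gradient_weight S p \<mu> (\<theta> (t - 1))"
  shows "\<forall>\<eta> \<in> cross_gradient_set S p \<mu>.
           1 / (\<Sum>t=1..T. \<gamma> t) * (\<Sum>t=1..T. \<gamma> t * (F (\<theta> (t - 1)) - F \<eta>))
           \<le> (norm (\<theta> 0 - \<eta>))\<^sup>2 / (2 * (\<Sum>t=1..T. \<gamma> t))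
             + B\<^sup>2 * ((\<Sum>t=1..T. (\<gamma> t)\<^sup>2) / (2 * (\<Sum>t=1..T. \<gamma> t)))"
proof
  fix \<eta> assume \<eta>: "\<eta> \<in> cross_gradient_set S p \<mu>"
  define g where "g t = cross_gradient_weight S p \<mu> (\<theta> (t - 1))" for t
  \<comment> \<open>Membership of \<open>\<eta>\<close> turns the point cross-gradient at each
    iterate into the weight cross-gradient that drives the iteration.\<close>
  have "F (\<theta> (t - 1)) - F \<eta> \<le> inner (g t) (\<theta> (t - 1) - \<eta>)" for t
    using mix_loss_diff_le_cross_gradient_point[where p = p and x = "\<theta> (t - 1)" and y = \<eta>,
        OF S p_diff p_log_concave] \<eta>
    by (simp add: F g_def cross_gradient_set_def)
  then have "2 * (\<Sum>t=1..T. \<gamma> t * (F (\<theta> (t - 1)) - F \<eta>))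
      \<le> 2 * (\<Sum>t=1..T. \<gamma> t * inner (g t) (\<theta> (t - 1) - \<eta>))"
    using \<gamma> by (intro mult_left_mono[of _ _ 2] sum_mono mult_left_mono) (auto intro: less_imp_le)
  also have "\<dots> \<le> (norm (\<theta> 0 - \<eta>))\<^sup>2 + B\<^sup>2 * (\<Sum>t=1..T. (\<gamma> t)\<^sup>2)"
  proof (rule subgradient_iteration_sum_le)
    show "\<theta> t = \<theta> (t - 1) - \<gamma> t *\<^sub>R g t" if "t \<in> {1..T}" for t
      using \<theta>[OF that] by (simp add: g_def)
    show "norm (g t) \<le> B" for t
      unfolding g_def using p_log_concave
      by (intro norm_cross_gradient_weight_le \<mu> p_diff lipschitz) (auto simp: log_concave_def)
  qed
  finally have *: "2 * (\<Sum>t=1..T. \<gamma> t * (F (\<theta> (t - 1)) - F \<eta>))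
      \<le> (norm (\<theta> 0 - \<eta>))\<^sup>2 + B\<^sup>2 * (\<Sum>t=1..T. (\<gamma> t)\<^sup>2)" .
  define G where "G = (\<Sum>t=1..T. \<gamma> t)"
  \<comment> \<open>The sum is nonempty since \<open>T \<ge> 1\<close>, so \<open>*\<close> may be
    divided by \<open>2 * G\<close>.\<close>
  have "0 < G"
    unfolding G_def using T \<gamma> by (intro sum_pos) auto
  with * show "1 / (\<Sum>t=1..T. \<gamma> t) * (\<Sum>t=1..T. \<gamma> t * (F (\<theta> (t - 1)) - F \<eta>))
      \<le> (norm (\<theta> 0 - \<eta>))\<^sup>2 / (2 * (\<Sum>t=1..T. \<gamma> t))
        + B\<^sup>2 * ((\<Sum>t=1..T. (\<gamma> t)\<^sup>2) / (2 * (\<Sum>t=1..T. \<gamma> t)))"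
    unfolding G_def[symmetric] by (simp add: field_simps)
qed

end
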